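(* There exist markets $\mathcal M,\widetilde{\mathcal M}$ such that $\widetilde{\mathcal M}$ is more consumer-informative than $\mathcal M$, and yet it is strictly worse in the long run: $S^{\mathrm{lnd}}(\widetilde{\mathcal M})\subset S^{\mathrm{lnd}}(\mathcal M)$ and $U(\widetilde{\mathcal M})<U(\mathcal M)$, almost surely over some coupling between the histories of $\mathcal M$ and $\widetilde{\mathcal M}$.
   Context: A market $\mathcal M$ consists of: $m$ businesses $j\in[m]$ with parameters $\pi_j\in(0,1)$ (fit probability) and $Q_j\in[0,1]$ (quality); fixed known prices $P_j\ge 0$; a value distribution $\mathcal D^V$ that is regular (with CDF $\Psi$ and density $\psi$, $v-(1-\Psi(v))/\psi(v)$ is non-decreasing), admits a density, and has bounded support contained in $[0,\overline V]$; a common prior, i.e. known prior distributions (possibly different for different businesses) from which the $\pi_j$ and $Q_j$ are independently drawn; and a search cost $c\ge 0$. The parameters of a market are a fixed potential realization of the prior; consumers know the prior but not the parameters. Dynamics: in round $i=1,2,\dots$ consumer $i$ arrives with value $V_i\sim\mathcal D^V$ (drawn independently). Each business $j$ has for this consumer a binary fit $F_{ij}$ (mean $\pi_j$) and a binary quality realization $q_{ij}$ (mean $Q_j$; if $q_{ij}$ and $F_{ij}$ are correlated, $Q_j$ is the mean of $q_{ij}$ given $F_{ij}=1$), independent across consumers and businesses. The consumer sequentially and adaptively inspects businesses, paying $c$ per inspection to observe $F_{ij}$; she may stop at any time and transact with at most one inspected business. Transacting with $j$ yields expected transaction utility $V_iQ_jF_{ij}-P_j$ given $F_{ij}$; total utility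 is transaction utility minus total search cost. After round $i$, the history records the inspected businesses with their $F_{ij}$, and the business transacted with (if any) with its $q_{ij}$; consumer $i$ sees the history $H^{\mathcal M}_{i-1}$ of the first $i-1$ rounds. Beliefs: $\mathcal P^F_{ij},\mathcal P^Q_{ij}$ are the Bayesian posteriors of $\pi_j,Q_j$ given $H^{\mathcal M}_{i-1}$, with means $\hat\pi_{ij},\hat Q_{ij}$. Consumers maximize expected utility given these beliefs, breaking ties in favor of not inspecting: with index $\sigma_{ij}=V_i\hat Q_{ij}-P_j-c/\hat\pi_{ij}$, consumer $i$ inspects the businesses with $\sigma_{ij}>0$ in decreasing order of index and transacts with the first inspected $j$ with $F_{ij}=1$ (if any), then leaves. Business $j$ is learned (for a realization of the infinite history) if $(\mathcal P^F_{ij},\mathcal P^Q_{ij})\to(\pi_j,Q_j)$ in probability as $i\to\infty$. $S^{\mathrm{lnd}}(\mathcal M)$ is the (random) set of learned businesses. For $S\subseteq[m]$, $U^*(S)$ is the optimal expected total utility of a consumer with value drawn from $\mathcal D^V$ who knows $(\pi_j,Q_j)$ for $j\in S$ exactly and may not transact with businesses outside $S$. $U(\mathcal M):=U^*(S^{\mathrm{lnd}}(\mathcal M))$ (a random variable, with randomness from the history). A coupling of two random objects is a joint distribution with the correct marginals. Sequential screening with search degree $k$: for each $i,j$ there is a sequence of $r$ binary random variables (screens) $f_{ij1},\dots,f_{ijr}$, which can be correlated with each other but are drawn independently for each consumer and business, with $\pi_{j\ell}=\Pr[f_{ij\ell}=1\mid f_{ij1}=\dots=f_{ij,\ell-1}=1]$;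 the fit is $F_{ij}=\prod_{\ell\le k}f_{ij\ell}$ and the quality realization is $q_{ij}=\prod_{\ell>k}f_{ij\ell}$, so $\pi_j=\prod_{\ell\le k}\pi_{j\ell}$ and $Q_j=\prod_{\ell>k}\pi_{j\ell}$. $\widetilde{\mathcal M}$ is more consumer-informative than $\mathcal M$ if both have sequential screening and are identical except that $\widetilde{\mathcal M}$ has a larger search degree $\tilde k\ge k$.
   Formalization: The common prior is on the screens' parameters and may correlate them; in each market consumers treat π_j and Q_j as independent with the induced marginal laws. If π_j and Q_j must be independent under the one common prior at both search degrees, the claim is false. *)

theory Defs
  imports "HOL-Probability.Probability"
begin

text \<open>Businesses and rounds are numbered from 0.\<close>

section \<open>Markets\<close>

text \<open>
  \<open>fit_quality M j\<close> is the joint law of \<open>(F\<^sub>i\<^sub>j, q\<^sub>i\<^sub>j)\<close>, the same for all consumers \<open>i\<close>. The prior draws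
  all \<open>\<pi>\<^sub>j\<close> and \<open>Q\<^sub>j\<close> independently: \<open>\<pi>\<^sub>j\<close> from \<open>fit_prior M j\<close> and \<open>Q\<^sub>j\<close> from \<open>quality_prior M j\<close>.
\<close>

record market =
  businesses :: nat
  fit_quality :: "nat \<Rightarrow> (bool \<times> bool) pmf"
  price :: "nat \<Rightarrow> real"
  cost :: real
  value_dist :: "real measure"
  fit_prior :: "nat \<Rightarrow> real measure"
  quality_prior :: "nat \<Rightarrow> real measure"

definition fit_prob :: "market \<Rightarrow> nat \<Rightarrow> real" where
  "fit_prob M j = measure (measure_pmf (fit_quality M j)) {x. fst x}"

text \<open>The mean of \<open>q\<^sub>i\<^sub>j\<close> given \<open>F\<^sub>i\<^sub>j = 1\<close>, which also covers correlated \<open>F\<^sub>i\<^sub>j\<close> and \<open>q\<^sub>i\<^sub>j\<close>.\<close>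

definition quality :: "market \<Rightarrow> nat \<Rightarrow> real" where
  "quality M j = cond_prob (measure_pmf (fit_quality M j)) snd fst"

text \<open>
  The virtual value \<open>v - (1 - \<Psi>(v)) / \<psi>(v)\<close> is \<open>-\<infinity>\<close> where \<open>\<psi>\<close> vanishes below the top of the support, so
  monotonicity rules out gaps in the support; hence the interval condition.
\<close>

definition regular_value_dist :: "real measure \<Rightarrow> bool" where
  "regular_value_dist D \<longleftrightarrow>
     prob_space D \<and>
     (\<exists>Vbar. AE v in D. 0 \<le> v \<and> v \<le> Vbar) \<and>
     (\<exists>\<psi> \<in> borel_measurable borel.
        (\<forall>v. 0 \<le> \<psi> v) \<and> D = density lborel (\<lambda>v. ennreal (\<psi> v)) \<and>
        is_interval {v. 0 < \<psi> v} \<and>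
        mono_on {v. 0 < \<psi> v} (\<lambda>v. v - (1 - cdf D v) / \<psi> v))"

definition in_support :: "real measure \<Rightarrow> real \<Rightarrow> bool" where
  "in_support \<mu> x \<longleftrightarrow> (\<forall>\<epsilon>>0. 0 < measure \<mu> {y. \<bar>y - x\<bar> < \<epsilon>})"

text \<open>The parameters are a potential realization of the prior: they lie in its support.\<close>

definition valid_market :: "market \<Rightarrow> bool" where
  "valid_market M \<longleftrightarrow>
     0 < businesses M \<and> 0 \<le> cost M \<and> regular_value_dist (value_dist M) \<and>
     (\<forall>j < businesses M.
        0 < fit_prob M j \<and> fit_prob M j < 1 \<and>
        0 \<le> quality M j \<and> quality M j \<le> 1 \<and>
        0 \<le> price M j \<and>
        prob_space (fit_prior M j) \<and> sets (fit_prior M j) = sets borel \<and>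
        (AE x in fit_prior M j. 0 < x \<and> x < 1) \<and> in_support (fit_prior M j) (fit_prob M j) \<and>
        prob_space (quality_prior M j) \<and> sets (quality_prior M j) = sets borel \<and>
        (AE x in quality_prior M j. 0 \<le> x \<and> x \<le> 1) \<and> in_support (quality_prior M j) (quality M j))"

section \<open>Histories and beliefs\<close>

text \<open>
  One round of the history: the inspected businesses, in order of inspection, with their fits; and
  the business transacted with, if any, with its quality realization.
\<close>

type_synonym round_record = "(nat \<times> bool) list \<times> (nat \<times> bool) option"

definition observed_fits :: "nat \<Rightarrow> round_record list \<Rightarrow> bool list" where
  "observed_fits j h = [b. (insp, t) \<leftarrow> h, (j', b) \<leftarrow> insp, j' = j]"

definition observed_qualities :: "nat \<Rightarrow> round_record list \<Rightarrow> bool list" where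
  "observed_qualities j h = [b. (insp, Some (j', b)) \<leftarrow> h, j' = j]"

definition bernoulli_likelihood :: "bool list \<Rightarrow> real \<Rightarrow> real" where
  "bernoulli_likelihood xs p = (\<Prod>x\<leftarrow>xs. if x then p else 1 - p)"

text \<open>
  Bayes' rule. Given the earlier rounds and the observed fits, the set of inspected businesses
  depends on \<open>V\<^sub>i\<close> alone, so the likelihood of a history is a parameter-free factor times the product over
  \<open>j\<close> of the Bernoulli likelihoods of the fits (in \<open>\<pi>\<^sub>j\<close>) and of the qualities (in \<open>Q\<^sub>j\<close>). As the prior is
  a product, the marginal posteriors of \<open>\<pi>\<^sub>j\<close> and \<open>Q\<^sub>j\<close> are the following.
\<close>

definition bayes_posterior :: "real measure \<Rightarrow> bool list \<Rightarrow> real measure" where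
  "bayes_posterior \<mu> xs =
     density \<mu> (\<lambda>p. ennreal (bernoulli_likelihood xs p / (\<integral>p'. bernoulli_likelihood xs p' \<partial>\<mu>)))"

definition fit_posterior :: "market \<Rightarrow> round_record list \<Rightarrow> nat \<Rightarrow> real measure" where
  "fit_posterior M h j = bayes_posterior (fit_prior M j) (observed_fits j h)"

definition quality_posterior :: "market \<Rightarrow> round_record list \<Rightarrow> nat \<Rightarrow> real measure" where
  "quality_posterior M h j = bayes_posterior (quality_prior M j) (observed_qualities j h)"

definition search_index :: "market \<Rightarrow> round_record list \<Rightarrow> real \<Rightarrow> nat \<Rightarrow> real" where
  "search_index M h v j =
     v * (\<integral>x. x \<partial>quality_posterior M h j) - price M j - cost M / (\<integral>x. x \<partial>fit_posterior M h j)"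

text \<open>Equal indices are resolved in favor of the smaller business number (\<open>sort_key\<close> is stable).\<close>

definition inspection_order :: "market \<Rightarrow> round_record list \<Rightarrow> real \<Rightarrow> nat list" where
  "inspection_order M h v =
     sort_key (\<lambda>j. - search_index M h v j) [j \<leftarrow> [0..<businesses M]. 0 < search_index M h v j]"

fun inspect :: "(nat \<Rightarrow> bool) \<Rightarrow> nat list \<Rightarrow> (nat \<times> bool) list" where
  "inspect F [] = []"
| "inspect F (j # js) = (j, F j) # (if F j then [] else inspect F js)"

text \<open>A draw consists of a consumer's value \<open>V\<^sub>i\<close> and the pairs \<open>(F\<^sub>i\<^sub>j, q\<^sub>i\<^sub>j)\<close>.\<close>

definition play_round ::
  "market \<Rightarrow> round_record list \<Rightarrow> real \<times> (nat \<Rightarrow> bool \<times> bool) \<Rightarrow> round_record" where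
  "play_round M h = (\<lambda>(v, x).
     (inspect (\<lambda>j. fst (x j)) (inspection_order M h v),
      map_option (\<lambda>j. (j, snd (x j))) (find (\<lambda>j. fst (x j)) (inspection_order M h v))))"

fun rounds_upto ::
  "market \<Rightarrow> (nat \<Rightarrow> real \<times> (nat \<Rightarrow> bool \<times> bool)) \<Rightarrow> nat \<Rightarrow> round_record list" where
  "rounds_upto M \<omega> 0 = []"
| "rounds_upto M \<omega> (Suc i) = rounds_upto M \<omega> i @ [play_round M (rounds_upto M \<omega> i) (\<omega> i)]"

definition infinite_history ::
  "market \<Rightarrow> (nat \<Rightarrow> real \<times> (nat \<Rightarrow> bool \<times> bool)) \<Rightarrow> nat \<Rightarrow> round_record" where
  "infinite_history M \<omega> i = play_round M (rounds_upto M \<omega> i) (\<omega> i)"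

definition draws :: "market \<Rightarrow> (nat \<Rightarrow> real \<times> (nat \<Rightarrow> bool \<times> bool)) measure" where
  "draws M = (\<Pi>\<^sub>M i\<in>UNIV. value_dist M \<Otimes>\<^sub>M (\<Pi>\<^sub>M j\<in>{..<businesses M}. measure_pmf (fit_quality M j)))"

definition history_law :: "market \<Rightarrow> (nat \<Rightarrow> round_record) measure" where
  "history_law M = distr (draws M) (\<Pi>\<^sub>M i\<in>UNIV. count_space UNIV) (infinite_history M)"

definition coupling :: "('a \<times> 'b) measure \<Rightarrow> 'a measure \<Rightarrow> 'b measure \<Rightarrow> bool" where
  "coupling C A B \<longleftrightarrow>
     prob_space C \<and> sets C = sets (A \<Otimes>\<^sub>M B) \<and> distr C A fst = A \<and> distr C B snd = B"

section \<open>Learned businesses and long-run utility\<close>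

definition concentrates_at :: "(nat \<Rightarrow> real measure) \<Rightarrow> real \<Rightarrow> bool" where
  "concentrates_at \<mu> \<theta> \<longleftrightarrow> (\<forall>\<epsilon>>0. (\<lambda>i. measure (\<mu> i) {x. \<bar>x - \<theta>\<bar> < \<epsilon>}) \<longlonglongrightarrow> 1)"

definition learned_set :: "market \<Rightarrow> (nat \<Rightarrow> round_record) \<Rightarrow> nat set" where
  "learned_set M H = {j. j < businesses M \<and>
     concentrates_at (\<lambda>i. fit_posterior M (map H [0..<i]) j) (fit_prob M j) \<and>
     concentrates_at (\<lambda>i. quality_posterior M (map H [0..<i]) j) (quality M j)}"

text \<open>
  Adaptive search strategies of a single consumer; in \<open>Inspect j s t\<close> she continues with \<open>s\<close> if \<open>j\<close> is a
  fit and with \<open>t\<close> otherwise.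
\<close>

datatype strategy = Leave | Transact nat | Inspect nat strategy strategy

text \<open>\<open>I\<close> is the set of businesses inspected so far; transactions are confined to \<open>S\<close>.\<close>

fun admissible :: "market \<Rightarrow> nat set \<Rightarrow> nat set \<Rightarrow> strategy \<Rightarrow> bool" where
  "admissible M S I Leave \<longleftrightarrow> True"
| "admissible M S I (Transact j) \<longleftrightarrow> j \<in> S \<and> j \<in> I"
| "admissible M S I (Inspect j s t) \<longleftrightarrow>
     j < businesses M \<and> j \<notin> I \<and> admissible M S (insert j I) s \<and> admissible M S (insert j I) t"

text \<open>\<open>F\<close> records the fits observed so far (its values at businesses not yet inspected are irrelevant).\<close>

fun strategy_utility :: "market \<Rightarrow> real \<Rightarrow> (nat \<Rightarrow> bool) \<Rightarrow> strategy \<Rightarrow> real" where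
  "strategy_utility M v F Leave = 0"
| "strategy_utility M v F (Transact j) = v * quality M j * of_bool (F j) - price M j"
| "strategy_utility M v F (Inspect j s t) =
     - cost M + fit_prob M j * strategy_utility M v (F(j := True)) s
       + (1 - fit_prob M j) * strategy_utility M v (F(j := False)) t"

text \<open>
  The supremum may pick a strategy depending on \<open>v\<close> and on all parameters. Those of businesses outside
  \<open>S\<close> are of no use, as such businesses cannot be transacted with and fits are independent.
\<close>

definition optimal_utility :: "market \<Rightarrow> nat set \<Rightarrow> real" where
  "optimal_utility M S =
     (\<integral>v. (SUP s\<in>{s. admissible M S {} s}. strategy_utility M v (\<lambda>_. False) s) \<partial>value_dist M)"

definition long_run_utility :: "market \<Rightarrow> (nat \<Rightarrow> round_record) \<Rightarrow> real" where
  "long_run_utility M H = optimal_utility M (learned_set M H)"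

section \<open>Sequential screening\<close>

text \<open>
  Everything in a market with sequential screening except the search degree. \<open>screen_law E j\<close> is the
  joint law of the screens \<open>f\<^sub>i\<^sub>j\<^sub>l\<close>, \<open>l < screens E\<close>; \<open>screen_prior E j\<close> is the prior law of the vector of
  their success probabilities \<open>\<pi>\<^sub>j\<^sub>l\<close>.
\<close>

record screening =
  s_businesses :: nat
  screens :: nat
  screen_law :: "nat \<Rightarrow> (nat \<Rightarrow> bool) pmf"
  s_price :: "nat \<Rightarrow> real"
  s_cost :: real
  s_value_dist :: "real measure"
  screen_prior :: "nat \<Rightarrow> (nat \<Rightarrow> real) measure"

definition screen_prob :: "screening \<Rightarrow> nat \<Rightarrow> nat \<Rightarrow> real" where
  "screen_prob E j l = cond_prob (measure_pmf (screen_law E j)) (\<lambda>f. f l) (\<lambda>f. \<forall>l'<l. f l')"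

definition valid_screening :: "screening \<Rightarrow> bool" where
  "valid_screening E \<longleftrightarrow>
     (\<forall>j < s_businesses E.
        prob_space (screen_prior E j) \<and>
        sets (screen_prior E j) = sets (\<Pi>\<^sub>M l\<in>{..<screens E}. borel) \<and>
        (AE x in screen_prior E j. \<forall>l < screens E. 0 \<le> x l \<and> x l \<le> 1) \<and>
        (\<forall>\<epsilon>>0. 0 < measure (screen_prior E j)
           {x \<in> space (screen_prior E j). \<forall>l < screens E. \<bar>x l - screen_prob E j l\<bar> < \<epsilon>}))"

text \<open>
  The market with search degree \<open>k\<close>. Its priors for \<open>\<pi>\<^sub>j\<close> and \<open>Q\<^sub>j\<close> are the laws of
  \<open>\<Prod>l<k. \<pi>\<^sub>j\<^sub>l\<close> and \<open>\<Prod>l\<in>{k..<r}. \<pi>\<^sub>j\<^sub>l\<close> under the prior of the screens. As in every market, consumers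
  take \<open>\<pi>\<^sub>j\<close> and \<open>Q\<^sub>j\<close> to be drawn independently from these two laws; \<open>screen_prior\<close> itself may correlate
  the \<open>\<pi>\<^sub>j\<^sub>l\<close> of one business, and its joint law enters only through these marginals.
\<close>

definition screening_market :: "screening \<Rightarrow> nat \<Rightarrow> market" where
  "screening_market E k =
     \<lparr>businesses = s_businesses E,
      fit_quality = (\<lambda>j. map_pmf (\<lambda>f. (\<forall>l<k. f l, \<forall>l\<in>{k..<screens E}. f l)) (screen_law E j)),
      price = s_price E,
      cost = s_cost E,
      value_dist = s_value_dist E,
      fit_prior = (\<lambda>j. distr (screen_prior E j) borel (\<lambda>x. \<Prod>l<k. x l)),
      quality_prior = (\<lambda>j. distr (screen_prior E j) borel (\<lambda>x. \<Prod>l\<in>{k..<screens E}. x l))\<rparr>"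

definition more_consumer_informative :: "market \<Rightarrow> market \<Rightarrow> bool" where
  "more_consumer_informative Mt M \<longleftrightarrow>
     (\<exists>E k kt. valid_screening E \<and> k \<le> kt \<and> kt \<le> screens E \<and>
        M = screening_market E k \<and> Mt = screening_market E kt)"

text \<open>\<open>\<pi>\<^sub>j\<close> and \<open>Q\<^sub>j\<close> are the products of the \<open>\<pi>\<^sub>j\<^sub>l\<close> over \<open>l < k\<close> and over \<open>k \<le> l < r\<close>.\<close>

lemma prod_screen_prob:
  "(\<Prod>l<k. screen_prob E j l) = measure (measure_pmf (screen_law E j)) {f. \<forall>l<k. f l}"
proof (induction k)
  case 0
  then show ?case by simp
next
  case (Suc k)
  let ?m = "measure (measure_pmf (screen_law E j))"
  have eq: "{f. f k \<and> (\<forall>l<k. f l)} = {f. \<forall>l<Suc k. f l}"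
    by (auto simp: less_Suc_eq)
  have "?m {f. \<forall>l<Suc k. f l} = ?m {f. \<forall>l<k. f l} * screen_prob E j k"
  proof (cases "?m {f. \<forall>l<k. f l} = 0")
    case True
    have "?m {f. \<forall>l<Suc k. f l} \<le> ?m {f. \<forall>l<k. f l}"
      by (rule measure_pmf.finite_measure_mono) auto
    with True show ?thesis
      by (simp add: measure_le_0_iff)
  next
    case False
    then show ?thesis
      by (simp add: screen_prob_def cond_prob_def eq)
  qed
  with Suc show ?case by simp
qed

lemma fit_prob_screening_market:
  "fit_prob (screening_market E k) j = (\<Prod>l<k. screen_prob E j l)"
  by (simp add: fit_prob_def screening_market_def prod_screen_prob vimage_def)

lemma quality_screening_market:
  assumes "k \<le> screens E" and "fit_prob (screening_market E k) j \<noteq> 0"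
  shows "quality (screening_market E k) j = (\<Prod>l\<in>{k..<screens E}. screen_prob E j l)"
proof -
  let ?m = "measure (measure_pmf (screen_law E j))"
  have split: "(\<Prod>l<screens E. screen_prob E j l) =
      (\<Prod>l<k. screen_prob E j l) * (\<Prod>l\<in>{k..<screens E}. screen_prob E j l)"
    using prod.atLeastLessThan_concat[of 0 k "screens E" "screen_prob E j"] assms(1)
    by (simp add: atLeast0LessThan)
  have eq: "{f. (\<forall>l\<in>{k..<screens E}. f l) \<and> (\<forall>l<k. f l)} = {f. \<forall>l<screens E. f l}"
    using assms(1) by (force simp: not_less[symmetric])
  have "quality (screening_market E k) j =
      ?m {f. \<forall>l<screens E. f l} / fit_prob (screening_market E k) j"
    unfolding quality_def cond_prob_def
    by (simp add: screening_market_def vimage_def fit_prob_def eq[symmetric])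
  then show ?thesis
    using assms(2) split by (simp add: fit_prob_screening_market prod_screen_prob)
qed

end

theory Submission
  imports Defs
begin

text \<open>
  One business with three screens suffices. The success probability \<open>\<pi>\<^sub>0\<close> of the first screen is known, while
  those of the other two, \<open>\<pi>\<^sub>1\<close> and \<open>\<pi>\<^sub>2\<close>, are positively correlated under the prior and in truth equal to
  \<open>1\<close>. With search degree 1 the quality is \<open>\<pi>\<^sub>1 \<pi>\<^sub>2\<close> and an inspection is worthwhile at first if
  \<open>V E[\<pi>\<^sub>1 \<pi>\<^sub>2] > c / \<pi>\<^sub>0\<close>; as every quality realization is a success, beliefs only improve, so the
  business is transacted with infinitely often and learned. With search degree 2 consumers treat \<open>\<pi>\<^sub>0 \<pi>\<^sub>1\<close>
  and \<open>\<pi>\<^sub>2\<close> as independent, so an inspection needs \<open>V E[\<pi>\<^sub>1] E[\<pi>\<^sub>2] > c / \<pi>\<^sub>0\<close>. By the positive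
  correlation a cost can be chosen for which this fails for all \<open>V\<close>, while the first condition holds for
  high \<open>V\<close>. Both learned sets are then almost surely constant, and the independent coupling will do.
\<close>

section \<open>Two-point priors\<close>

text \<open>The case \<open>a = b\<close> is allowed and gives a point mass, the prior of a known
  parameter. The push-forward of a coin is chosen because the screen prior of the example is a
  push-forward of the same coin.\<close>

definition two_point :: "real \<Rightarrow> real \<Rightarrow> real measure" where
  "two_point a b = distr (measure_pmf (bernoulli_pmf (1/2))) borel (\<lambda>t. if t then a else b)"

lemma sets_two_point [simp, measurable_cong]: "sets (two_point a b) = sets borel"
  by (simp add: two_point_def)

lemma space_two_point [simp]: "space (two_point a b) = UNIV"
  by (simp add: two_point_def)

lemma prob_space_two_point: "prob_space (two_point a b)"
  unfolding two_point_def by (rule measure_pmf.prob_space_distr) simp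

lemma integral_two_point:
  fixes f :: "real \<Rightarrow> real"
  assumes "f \<in> borel_measurable borel"
  shows "(\<integral>x. f x \<partial>two_point a b) = (f a + f b) / 2"
  using assms by (simp add: two_point_def integral_distr field_simps)

lemma AE_two_point:
  assumes "P a" "P b"
  shows "AE x in two_point a b. P x"
proof -
  have "AE x in two_point a b. x \<in> {a, b}"
    unfolding two_point_def by (subst AE_distr_iff) auto
  then show ?thesis
    by eventually_elim (use assms in auto)
qed

lemma measure_two_point:
  assumes "A \<in> sets borel"
  shows "measure (two_point a b) A = (indicator A a + indicator A b) / 2"
  using integral_two_point[of "indicator A" a b] assms by simp

lemma in_support_two_point:
  "in_support (two_point a b) a" "in_support (two_point a b) b"
  by (auto simp: in_support_def measure_two_point indicator_def)

section \<open>Posteriors of a two-point prior\<close>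

lemma bernoulli_likelihood_Cons:
  "bernoulli_likelihood (x # xs) p = (if x then p else 1 - p) * bernoulli_likelihood xs p"
  by (simp add: bernoulli_likelihood_def)

lemma bernoulli_likelihood_Nil [simp]: "bernoulli_likelihood [] p = 1"
  by (simp add: bernoulli_likelihood_def)

lemma bernoulli_likelihood_measurable [measurable]:
  "bernoulli_likelihood xs \<in> borel_measurable borel"
proof (induction xs)
  case Nil
  then show ?case by (simp add: bernoulli_likelihood_def[abs_def])
next
  case (Cons x xs)
  note [measurable] = Cons.IH
  have eq: "bernoulli_likelihood (x # xs) =
      (\<lambda>p. (if x then p else 1 - p) * bernoulli_likelihood xs p)"
    by (simp add: fun_eq_iff bernoulli_likelihood_Cons)
  show ?case
    unfolding eq by measurable
qed

lemma bernoulli_likelihood_nonneg: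
  assumes "0 \<le> p" "p \<le> 1"
  shows "0 \<le> bernoulli_likelihood xs p"
  using assms by (induction xs) (auto simp: bernoulli_likelihood_Cons)

text \<open>Success and failure are equally likely at 1/2, so the likelihood is positive whatever
  was observed. Hence the point-mass prior at 1/2 is left unchanged by every history.\<close>

lemma bernoulli_likelihood_half: "bernoulli_likelihood xs (1/2) = (1/2) ^ length xs"
  by (induction xs) (auto simp: bernoulli_likelihood_Cons)

lemma bernoulli_likelihood_successes:
  assumes "set xs \<subseteq> {True}"
  shows "bernoulli_likelihood xs p = p ^ length xs"
  using assms by (induction xs) (auto simp: bernoulli_likelihood_Cons)

text \<open>The prior weights 1/2 cancel in Bayes' rule, leaving the average of \<open>f\<close>
  weighted by the likelihoods. If both likelihoods vanish, both sides are 0 by division by zero. The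
  bounds on \<open>a\<close> and \<open>b\<close> keep the density nonnegative, so that
  \<open>ennreal\<close> does not truncate it.\<close>

lemma integral_bayes_posterior_two_point:
  fixes f :: "real \<Rightarrow> real"
  assumes ab: "0 \<le> a" "a \<le> 1" "0 \<le> b" "b \<le> 1"
    and f [measurable]: "f \<in> borel_measurable borel"
  defines "L \<equiv> bernoulli_likelihood"
  shows "(\<integral>x. f x \<partial>bayes_posterior (two_point a b) xs) =
    (L xs a * f a + L xs b * f b) / (L xs a + L xs b)"
proof -
  define Z where "Z = (L xs a + L xs b) / 2"
  have Z: "(\<integral>p. L xs p \<partial>two_point a b) = Z"
    by (simp add: L_def Z_def integral_two_point)
  have [measurable]: "L xs \<in> borel_measurable borel"
    by (simp add: L_def)
  have nonneg: "0 \<le> L xs a" "0 \<le> L xs b"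
    using ab by (simp_all add: L_def bernoulli_likelihood_nonneg)
  then have "0 \<le> Z"
    by (simp add: Z_def)
  have "(\<integral>x. f x \<partial>bayes_posterior (two_point a b) xs) =
      (\<integral>x. L xs x / Z * f x \<partial>two_point a b)"
    unfolding bayes_posterior_def L_def[symmetric] Z
    using nonneg \<open>0 \<le> Z\<close>
    by (subst integral_density) (auto intro!: AE_two_point)
  also have "\<dots> = (L xs a / Z * f a + L xs b / Z * f b) / 2"
    by (subst integral_two_point) auto
  also have "\<dots> = (L xs a * f a + L xs b * f b) / (L xs a + L xs b)"
    by (simp add: Z_def add_divide_distrib)
  finally show ?thesis .
qed

lemma measure_bayes_posterior_two_point:
  assumes "0 \<le> a" "a \<le> 1" "0 \<le> b" "b \<le> 1" and "A \<in> sets borel"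
  defines "L \<equiv> bernoulli_likelihood"
  shows "measure (bayes_posterior (two_point a b) xs) A =
    (L xs a * indicator A a + L xs b * indicator A b) / (L xs a + L xs b)"
proof -
  have "space (bayes_posterior (two_point a b) xs) = UNIV"
    by (simp add: bayes_posterior_def)
  then show ?thesis
    using integral_bayes_posterior_two_point[OF assms(1-4), of "indicator A" xs] assms(5)
    by (simp add: L_def)
qed

section \<open>Independent repetition and couplings\<close>

text \<open>The second Borel-Cantelli lemma for independent repetitions: missing \<open>B\<close>
  from round \<open>n\<close> on entails missing it in rounds \<open>n\<close> to
  \<open>n + k - 1\<close>, which has probability \<open>(1 - measure N B) ^ k\<close> and vanishes
  as \<open>k\<close> grows.\<close>

lemma AE_PiM_infinitely_often:
  assumes N: "prob_space N" and B: "B \<in> sets N" and pos: "0 < measure N B"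
  shows "AE \<omega> in \<Pi>\<^sub>M i\<in>(UNIV::nat set). N. \<forall>n. \<exists>i\<ge>n. \<omega> i \<in> B"
proof -
  interpret N: prob_space N by (rule N)
  interpret P: product_prob_space "\<lambda>i::nat. N" UNIV ..
  let ?P = "\<Pi>\<^sub>M i\<in>(UNIV::nat set). N"
  have "AE \<omega> in ?P. \<exists>i\<ge>n. \<omega> i \<in> B" for n
  proof -
    let ?X = "{\<omega> \<in> space ?P. \<forall>i\<ge>n. \<omega> i \<notin> B}"
    have [measurable]: "B \<in> sets N" by (rule B)
    have X: "?X \<in> sets ?P" by measurable
    have "measure ?P ?X \<le> (1 - measure N B) ^ k" for k
    proof -
      let ?J = "{n..<n + k}"
      let ?Y = "prod_emb UNIV (\<lambda>_. N) ?J (\<Pi>\<^sub>E i\<in>?J. space N - B)"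
      have "?X \<subseteq> ?Y"
        by (auto simp: prod_emb_def space_PiM PiE_def Pi_def extensional_def)
      moreover have "?Y \<in> sets ?P"
        using B by (intro sets_PiM_I) auto
      ultimately have "measure ?P ?X \<le> measure ?P ?Y"
        by (intro P.finite_measure_mono)
      also have "\<dots> = (\<Prod>i\<in>?J. measure N (space N - B))"
        using B by (intro P.measure_PiM_emb) auto
      also have "\<dots> = (1 - measure N B) ^ k"
        using B by (simp add: N.prob_compl)
      finally show ?thesis .
    qed
    moreover have "(\<lambda>k. (1 - measure N B) ^ k) \<longlonglongrightarrow> 0"
      using pos N.prob_le_1[of B] by (intro LIMSEQ_realpow_zero) auto
    ultimately have "measure ?P ?X \<le> 0"
      by (intro LIMSEQ_le_const) auto
    then have "measure ?P ?X = 0"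
      by (simp add: measure_le_0_iff)
    then have "AE \<omega> in ?P. \<omega> \<notin> ?X"
      using X by (simp add: P.prob_eq_0)
    then show ?thesis
      by (rule AE_mp) auto
  qed
  then show ?thesis
    by (simp add: AE_all_countable)
qed

lemma distr_pair_snd:
  assumes "prob_space A" "prob_space B"
  shows "distr (A \<Otimes>\<^sub>M B) B snd = B"
proof (rule measure_eqI)
  interpret A: prob_space A by fact
  interpret B: prob_space B by fact
  fix X assume "X \<in> sets (distr (A \<Otimes>\<^sub>M B) B snd)"
  then have X: "X \<in> sets B" by simp
  then have "snd -` X \<inter> space (A \<Otimes>\<^sub>M B) = space A \<times> X"
    by (auto simp: space_pair_measure dest: sets.sets_into_space)
  then show "emeasure (distr (A \<Otimes>\<^sub>M B) B snd) X = emeasure B X"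
    using X by (simp add: emeasure_distr B.emeasure_pair_measure_Times A.emeasure_space_1)
qed simp

lemma coupling_pair_measure:
  assumes "prob_space A" "prob_space B"
  shows "coupling (A \<Otimes>\<^sub>M B) A B"
  using assms
  by (simp add: coupling_def prob_space_pair prob_space.distr_pair_fst distr_pair_snd)

text \<open>Each property is pulled back along the projection onto its marginal; this direction asks
  for no measurability of \<open>P\<close> or \<open>Q\<close>.\<close>

lemma AE_pair_fst_snd:
  assumes "prob_space A" "prob_space B" and "AE x in A. P x" and "AE y in B. Q y"
  shows "AE (x, y) in A \<Otimes>\<^sub>M B. P x \<and> Q y"
proof -
  have "AE z in A \<Otimes>\<^sub>M B. P (fst z)"
    using assms(3) prob_space.distr_pair_fst[OF assms(2), of A]
    by (intro AE_distrD[of fst _ A]) (simp_all only: measurable_fst)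
  moreover have "AE z in A \<Otimes>\<^sub>M B. Q (snd z)"
    using assms(4) distr_pair_snd[OF assms(1,2)]
    by (intro AE_distrD[of snd _ B]) (simp_all only: measurable_snd)
  ultimately show ?thesis
    by eventually_elim auto
qed

section \<open>Markets with a single business\<close>

lemma play_round_single:
  assumes "businesses M = 1"
  shows "play_round M h (v, x) =
    (if 0 < search_index M h v 0
     then if fst (x 0) then ([(0, True)], Some (0, snd (x 0))) else ([(0, False)], None)
     else ([], None))"
  using assms by (simp add: play_round_def inspection_order_def)

definition draw_space :: "market \<Rightarrow> (real \<times> (nat \<Rightarrow> bool \<times> bool)) measure" where
  "draw_space M = value_dist M \<Otimes>\<^sub>M (\<Pi>\<^sub>M j\<in>{..<businesses M}. measure_pmf (fit_quality M j))"

lemma draws_eq: "draws M = (\<Pi>\<^sub>M i\<in>UNIV. draw_space M)"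
  by (simp add: draws_def draw_space_def)

lemma prob_space_draw_space: "prob_space (value_dist M) \<Longrightarrow> prob_space (draw_space M)"
  unfolding draw_space_def
  by (intro prob_space_pair prob_space_PiM measure_pmf.prob_space_axioms)

lemma prob_space_draws: "prob_space (value_dist M) \<Longrightarrow> prob_space (draws M)"
  unfolding draws_eq by (intro prob_space_PiM prob_space_draw_space)

lemma AE_draw_space:
  assumes "prob_space (value_dist M)" and "AE v in value_dist M. P v"
    and "\<And>j y. j < businesses M \<Longrightarrow> y \<in> set_pmf (fit_quality M j) \<Longrightarrow> Q j y"
  shows "AE (v, x) in draw_space M. P v \<and> (\<forall>j<businesses M. Q j (x j))"
proof -
  have "AE x in \<Pi>\<^sub>M j\<in>{..<businesses M}. measure_pmf (fit_quality M j).
      \<forall>j\<in>{..<businesses M}. Q j (x j)"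
    using assms(3)
    by (intro AE_finite_allI AE_PiM_component)
      (auto simp: AE_measure_pmf_iff intro: measure_pmf.prob_space_axioms)
  then show ?thesis
    using assms(1,2) unfolding draw_space_def
    by (intro AE_pair_fst_snd)
      (auto intro!: prob_space_PiM measure_pmf.prob_space_axioms)
qed

text \<open>For a fixed history the record depends on the draw only through the sign of an index
  affine in the value and through the discrete pair of business 0.\<close>

lemma measurable_play_round_single:
  assumes M: "businesses M = 1" and D: "sets (value_dist M) = sets borel"
  shows "play_round M h \<in> draw_space M \<rightarrow>\<^sub>M count_space UNIV"
proof -
  note [measurable_cong] = D
  let ?X = "\<Pi>\<^sub>M j\<in>{..<businesses M}. measure_pmf (fit_quality M j)"
  let ?g = "\<lambda>y :: bool \<times> bool.
    if fst y then ([(0 :: nat, True)], Some (0 :: nat, snd y)) else ([(0, False)], None)"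
  have "(\<lambda>x. x 0) \<in> ?X \<rightarrow>\<^sub>M measure_pmf (fit_quality M 0)"
    using M by (intro measurable_component_singleton) simp
  then have "(\<lambda>x. x 0) \<in> ?X \<rightarrow>\<^sub>M count_space UNIV"
    by (simp cong: measurable_cong_sets)
  then have "(\<lambda>z. snd z 0) \<in> value_dist M \<Otimes>\<^sub>M ?X \<rightarrow>\<^sub>M count_space UNIV"
    by (rule measurable_compose[OF measurable_snd])
  then have g: "(\<lambda>z. ?g (snd z 0)) \<in> draw_space M \<rightarrow>\<^sub>M count_space UNIV"
    unfolding draw_space_def by (rule measurable_compose) simp
  have "(\<lambda>v. search_index M h v 0) \<in> borel_measurable (value_dist M)"
    unfolding search_index_def by measurable
  then have "(\<lambda>z. search_index M h (fst z) 0) \<in> borel_measurable (draw_space M)"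
    unfolding draw_space_def by (rule measurable_compose[OF measurable_fst])
  then have idx: "Measurable.pred (draw_space M) (\<lambda>z. 0 < search_index M h (fst z) 0)"
    by measurable
  have eq: "play_round M h =
      (\<lambda>z. if 0 < search_index M h (fst z) 0 then ?g (snd z 0) else ([], None))"
    by (simp add: fun_eq_iff play_round_single[OF M])
  show ?thesis
    unfolding eq using idx by (intro measurable_If[OF g]) (simp_all add: pred_def)
qed

text \<open>The past on which a round depends is itself random, but finite histories form a
  countable type. It is therefore enough to treat each fixed past and glue the pieces with
  \<open>measurable_compose_countable\<close>.\<close>

lemma measurable_infinite_history_single:
  assumes M: "businesses M = 1" and D: "sets (value_dist M) = sets borel"
  shows "infinite_history M \<in> draws M \<rightarrow>\<^sub>M (\<Pi>\<^sub>M i\<in>UNIV. count_space UNIV)"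
proof -
  have play: "(\<lambda>\<omega>. play_round M h (\<omega> i)) \<in> draws M \<rightarrow>\<^sub>M count_space UNIV" for h i
    unfolding draws_eq
    by (rule measurable_compose[OF _ measurable_play_round_single[OF assms]],
        rule measurable_component_singleton) simp
  have rounds: "(\<lambda>\<omega>. rounds_upto M \<omega> i) \<in> draws M \<rightarrow>\<^sub>M count_space UNIV" for i
  proof (induction i)
    case 0
    then show ?case by simp
  next
    case (Suc i)
    have "(\<lambda>\<omega>. h @ [play_round M h (\<omega> i)]) \<in> draws M \<rightarrow>\<^sub>M count_space UNIV" for h
      by (rule measurable_compose[OF play]) simp
    from measurable_compose_countable[OF this Suc.IH] show ?case
      by simp
  qed
  have "(\<lambda>\<omega>. infinite_history M \<omega> i) \<in> draws M \<rightarrow>\<^sub>M count_space UNIV" for i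
    unfolding infinite_history_def by (rule measurable_compose_countable[OF play rounds])
  then show ?thesis
    by (intro measurable_PiM_single') auto
qed

lemma rounds_upto_eq: "rounds_upto M \<omega> i = map (infinite_history M \<omega>) [0..<i]"
  by (induction i) (simp_all add: infinite_history_def)

text \<open>Value and fit are independent, so the event is a rectangle. It is an event of the draw
  and not of the history, which makes its occurrences in different rounds independent.\<close>

lemma measure_draw_space_single:
  assumes M: "businesses M = 1" and D: "prob_space (value_dist M)"
    and A: "A \<in> sets (value_dist M)"
  defines "B \<equiv> {z \<in> space (draw_space M). fst z \<in> A \<and> fst (snd z 0)}"
  shows "B \<in> sets (draw_space M)"
    and "measure (draw_space M) B = measure (value_dist M) A * fit_prob M 0"
proof -
  let ?I = "{..<businesses M}" and ?Q = "\<lambda>j. measure_pmf (fit_quality M j)"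
  let ?X = "\<Pi>\<^sub>M j\<in>?I. ?Q j"
  let ?Y = "(\<lambda>x. x 0) -` {y. fst y} \<inter> space ?X"
  have X: "prob_space ?X"
    by (intro prob_space_PiM measure_pmf.prob_space_axioms)
  interpret X: prob_space ?X by (rule X)
  have comp: "(\<lambda>x. x 0) \<in> ?X \<rightarrow>\<^sub>M ?Q 0"
    using M by (intro measurable_component_singleton) simp
  then have Y: "?Y \<in> sets ?X"
    by (rule measurable_sets) simp
  have B_eq: "B = A \<times> ?Y"
    using sets.sets_into_space[OF A] by (auto simp: B_def draw_space_def space_pair_measure)
  show "B \<in> sets (draw_space M)"
    unfolding B_eq draw_space_def using A Y by simp
  have "measure ?X ?Y = measure (distr ?X (?Q 0) (\<lambda>x. x 0)) {y. fst y}"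
    using comp by (simp add: measure_distr)
  also have "distr ?X (?Q 0) (\<lambda>x. x 0) = ?Q 0"
    using M by (intro distr_PiM_component measure_pmf.prob_space_axioms) simp
  finally have "measure ?X ?Y = fit_prob M 0"
    by (simp add: fit_prob_def)
  moreover have "measure (value_dist M \<Otimes>\<^sub>M ?X) (A \<times> ?Y) =
      measure (value_dist M) A * measure ?X ?Y"
    using A Y by (simp add: measure_def X.emeasure_pair_measure_Times enn2real_mult)
  ultimately show "measure (draw_space M) B = measure (value_dist M) A * fit_prob M 0"
    by (simp add: B_eq draw_space_def)
qed

lemma AE_draws_all:
  assumes "prob_space (value_dist M)" and "AE z in draw_space M. P z"
  shows "AE \<omega> in draws M. \<forall>i. P (\<omega> i)"
  unfolding draws_eq AE_all_countable
  using assms by (intro allI AE_PiM_component prob_space_draw_space) auto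

lemma prob_space_history_law_single:
  assumes "businesses M = 1" "prob_space (value_dist M)" "sets (value_dist M) = sets borel"
  shows "prob_space (history_law M)"
  unfolding history_law_def
  using assms prob_space_draws measurable_infinite_history_single
  by (intro prob_space.prob_space_distr) auto

lemma AE_history_law_single:
  assumes M: "businesses M = 1" and D: "sets (value_dist M) = sets borel"
    and G: "Measurable.pred (\<Pi>\<^sub>M i\<in>UNIV. count_space UNIV) G"
    and AE: "AE \<omega> in draws M. G (infinite_history M \<omega>)"
  shows "AE H in history_law M. G H"
  unfolding history_law_def
  using AE G AE_distr_iff[OF measurable_infinite_history_single[OF M D]]
  by (simp add: pred_def)

lemma pred_history_component:
  "Measurable.pred (\<Pi>\<^sub>M i\<in>(UNIV::nat set). count_space UNIV) (\<lambda>H. P (H i))"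
  by (rule measurable_compose[OF measurable_component_singleton]) auto

section \<open>Optimal utility with at most one learned business\<close>

lemma strategy_utility_no_transactions:
  assumes "0 \<le> cost M" and "admissible M {} I s"
  shows "strategy_utility M v F s \<le> 0"
  using assms(2)
\<comment> \<open>No \<open>Transact\<close> leaf is admissible when transactions are confined to
  the empty set, so a strategy can only accumulate inspection costs.\<close>
proof (induction s arbitrary: I F)
  case (Inspect j s t)
  have p: "0 \<le> fit_prob M j" "fit_prob M j \<le> 1"
    by (simp_all add: fit_prob_def)
  have "fit_prob M j * strategy_utility M v (F(j := True)) s \<le> 0"
    using Inspect p by (intro mult_nonneg_nonpos) auto
  moreover have "(1 - fit_prob M j) * strategy_utility M v (F(j := False)) t \<le> 0"
    using Inspect p by (intro mult_nonneg_nonpos) auto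
  ultimately show ?case
    using assms(1) by simp
qed auto

lemma optimal_utility_empty:
  assumes "0 \<le> cost M"
  shows "optimal_utility M {} = 0"
proof -
  have "(SUP s\<in>{s. admissible M {} {} s}. strategy_utility M v (\<lambda>_. False) s) = 0" for v
    using assms
    by (intro cSup_eq_maximum)
      (auto intro: strategy_utility_no_transactions rev_image_eqI[of Leave])
  then show ?thesis
    by (simp add: optimal_utility_def)
qed

text \<open>Once the only business is inspected, the consumer can only transact or leave. At price
  0, transacting after a misfit is worth as much as leaving, so every strategy is worth 0, minus the
  cost, or the value of inspecting and transacting upon a fit.\<close>

lemma optimal_utility_single_free:
  assumes M: "businesses M = 1" and P: "price M 0 = 0" and c: "0 \<le> cost M"
    and Q: "0 \<le> quality M 0"
  shows "optimal_utility M {0} =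
    (\<integral>v. max 0 (v * quality M 0 * fit_prob M 0 - cost M) \<partial>value_dist M)"
proof -
  let ?u = "\<lambda>v. v * quality M 0 * fit_prob M 0 - cost M"
  have p: "0 \<le> fit_prob M 0" "fit_prob M 0 \<le> 1"
    by (simp_all add: fit_prob_def)
  have inspected: "s = Leave \<or> s = Transact 0" if "admissible M {0} {0} s" for s
    using that M by (cases s) auto
  have bound: "strategy_utility M v (\<lambda>_. False) s \<le> max 0 (?u v)"
    if s: "admissible M {0} {} s" for s v
  proof (cases s)
    case (Inspect j s1 s2)
    with s M have j: "j = 0" and "admissible M {0} {0} s1" "admissible M {0} {0} s2"
      by auto
    then have s1: "s1 = Leave \<or> s1 = Transact 0" and s2: "s2 = Leave \<or> s2 = Transact 0"
      using inspected by blast+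
    show ?thesis
      using s1 s2 c by (auto simp: Inspect j P ac_simps)
  qed (use s in auto)
  have "(SUP s\<in>{s. admissible M {0} {} s}. strategy_utility M v (\<lambda>_. False) s) = max 0 (?u v)" for v
  proof (rule cSup_eq_maximum)
    let ?s = "if 0 \<le> ?u v then Inspect 0 (Transact 0) Leave else Leave"
    have "strategy_utility M v (\<lambda>_. False) ?s = max 0 (?u v)"
      by (auto simp: P)
    moreover have "admissible M {0} {} ?s"
      using M by simp
    ultimately show "max 0 (?u v) \<in>
        (\<lambda>s. strategy_utility M v (\<lambda>_. False) s) ` {s. admissible M {0} {} s}"
      by (intro rev_image_eqI[of ?s]) auto
  qed (use bound in auto)
  then show ?thesis
    by (simp add: optimal_utility_def)
qed

section \<open>The uniform distribution on the unit interval\<close>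

definition uniform01 :: "real measure" where
  "uniform01 = density lborel (\<lambda>v. ennreal (indicator {0..1} v))"

lemma sets_uniform01 [simp, measurable_cong]: "sets uniform01 = sets borel"
  by (simp add: uniform01_def)

lemma space_uniform01 [simp]: "space uniform01 = UNIV"
  by (simp add: uniform01_def)

lemma emeasure_uniform01:
  "A \<in> sets borel \<Longrightarrow> emeasure uniform01 A = emeasure lborel ({0..1} \<inter> A)"
  by (simp add: uniform01_def emeasure_density ennreal_indicator indicator_inter_arith[symmetric])

lemma prob_space_uniform01: "prob_space uniform01"
  by (rule prob_spaceI) (simp add: emeasure_uniform01)

lemma AE_uniform01: "AE v in uniform01. 0 \<le> v \<and> v \<le> 1"
  unfolding uniform01_def by (subst AE_density) (auto simp: indicator_def)

lemma cdf_uniform01: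
  assumes "0 \<le> v" "v \<le> 1"
  shows "cdf uniform01 v = v"
proof -
  have "{0..1} \<inter> {..v} = {0..v}"
    using assms by auto
  then show ?thesis
    using assms by (simp add: cdf_def measure_def emeasure_uniform01)
qed

lemma measure_uniform01_greaterThan:
  assumes "0 \<le> a" "a \<le> 1"
  shows "measure uniform01 {a<..} = 1 - a"
proof -
  have "{0..1} \<inter> {a<..} = {a<..1}"
    using assms by auto
  then show ?thesis
    using assms by (simp add: measure_def emeasure_uniform01)
qed

lemma regular_uniform01: "regular_value_dist uniform01"
proof -
  let ?\<psi> = "indicator {0..1} :: real \<Rightarrow> real"
  have supp: "{v. 0 < ?\<psi> v} = {0..1}"
    by (auto simp: indicator_def)
  \<comment> \<open>On the unit interval the virtual value is 2v - 1.\<close>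
  have "mono_on {0..1} (\<lambda>v. v - (1 - cdf uniform01 v) / ?\<psi> v)"
    by (auto simp: mono_on_def cdf_uniform01)
  then have "?\<psi> \<in> borel_measurable borel \<and> (\<forall>v. 0 \<le> ?\<psi> v) \<and>
      uniform01 = density lborel (\<lambda>v. ennreal (?\<psi> v)) \<and> is_interval {v. 0 < ?\<psi> v} \<and>
      mono_on {v. 0 < ?\<psi> v} (\<lambda>v. v - (1 - cdf uniform01 v) / ?\<psi> v)"
    unfolding supp by (auto simp: uniform01_def is_interval_cc)
  then show ?thesis
    unfolding regular_value_dist_def using prob_space_uniform01 AE_uniform01 by blast
qed

section \<open>The two markets\<close>

text \<open>
  The prior takes \<open>\<pi>\<^sub>1 = \<pi>\<^sub>2\<close>, which is \<open>1\<close> or \<open>1/2\<close> with equal probability, so that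
  \<open>E[\<pi>\<^sub>1] E[\<pi>\<^sub>2] = 9/16 < 3/5 < 5/8 = E[\<pi>\<^sub>1 \<pi>\<^sub>2]\<close>; the constant \<open>3/5\<close> is
  the search cost divided by \<open>\<pi>\<^sub>0 = 1/2\<close>.
\<close>

definition example_screening :: screening where
  "example_screening =
     \<lparr>s_businesses = 1,
      screens = 3,
      screen_law = (\<lambda>_. map_pmf (\<lambda>t l. l = 0 \<longrightarrow> t) (bernoulli_pmf (1/2))),
      s_price = (\<lambda>_. 0),
      s_cost = 3/10,
      s_value_dist = uniform01,
      screen_prior = (\<lambda>_. distr (measure_pmf (bernoulli_pmf (1/2))) (\<Pi>\<^sub>M l\<in>{..<3}. borel)
        (\<lambda>t. \<lambda>l\<in>{..<3}. if l = 0 then 1/2 else if t then 1 else 1/2))\<rparr>"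

definition coarse_market :: market where
  "coarse_market = screening_market example_screening 1"

definition fine_market :: market where
  "fine_market = screening_market example_screening 2"

lemma example_screening_simps [simp]:
  "s_businesses example_screening = 1"
  "screens example_screening = 3"
  by (simp_all add: example_screening_def)

lemma example_market_simps [simp]:
  "businesses coarse_market = 1" "businesses fine_market = 1"
  "price coarse_market j = 0" "price fine_market j = 0"
  "cost coarse_market = 3/10" "cost fine_market = 3/10"
  "value_dist coarse_market = uniform01" "value_dist fine_market = uniform01"
  by (simp_all add: coarse_market_def fine_market_def screening_market_def example_screening_def)

lemma all_less_3: "(\<forall>l<(3::nat). P l) \<longleftrightarrow> P 0 \<and> P 1 \<and> P 2"
  by (auto simp: less_Suc_eq numeral_3_eq_3 numeral_2_eq_2)

lemma screen_prob_example: "screen_prob example_screening j l = (if l = 0 then 1/2 else 1)"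
proof -
  have "{t. (l = 0 \<longrightarrow> t) \<and> (\<forall>l'<l. l' = 0 \<longrightarrow> t)} = {True}"
    by auto
  moreover have "{t. \<forall>l'<l. l' = 0 \<longrightarrow> t} = (if l = 0 then UNIV else {True})"
    by auto
  ultimately show ?thesis
    by (simp add: screen_prob_def cond_prob_def example_screening_def vimage_def
        measure_pmf_single)
qed

lemma fit_prob_example [simp]: "fit_prob coarse_market j = 1/2" "fit_prob fine_market j = 1/2"
  by (simp_all add: coarse_market_def fine_market_def fit_prob_screening_market
      screen_prob_example numeral_2_eq_2)

lemma quality_example [simp]: "quality coarse_market j = 1" "quality fine_market j = 1"
  by (simp_all add: coarse_market_def fine_market_def quality_screening_market
      fit_prob_screening_market screen_prob_example)

lemma quality_realization_coarse:
  "y \<in> set_pmf (fit_quality coarse_market j) \<Longrightarrow> snd y"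
  by (auto simp: coarse_market_def screening_market_def example_screening_def)

text \<open>One coin determines all screen probabilities of a business, hence every product of them
  has a two-point law. On \<open>True\<close> only screen 0 contributes a factor 1/2; on
  \<open>False\<close> every screen does.\<close>

lemma priors_example [simp]:
  "fit_prior coarse_market j = two_point (1/2) (1/2)"
  "quality_prior coarse_market j = two_point 1 (1/4)"
  "fit_prior fine_market j = two_point (1/2) (1/4)"
  "quality_prior fine_market j = two_point 1 (1/2)"
proof -
  let ?b = "measure_pmf (bernoulli_pmf (1/2))" and ?N = "\<Pi>\<^sub>M l\<in>{..<3::nat}. borel :: real measure"
  let ?f = "\<lambda>t. \<lambda>l\<in>{..<3::nat}. if l = 0 then 1/2 else if t then 1 else 1/2 :: real"
  have prod: "distr (screen_prior example_screening j) borel (\<lambda>x. \<Prod>l\<in>J. x l) =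
      two_point (\<Prod>l\<in>J. if l = 0 then 1/2 else 1) (\<Prod>l\<in>J. 1/2)" if J: "J \<subseteq> {..<3}" for J
  proof -
    have g: "(\<lambda>x. \<Prod>l\<in>J. x l) \<in> borel_measurable ?N"
      using J by (intro borel_measurable_prod measurable_component_singleton) auto
    have f: "?f \<in> ?b \<rightarrow>\<^sub>M ?N"
      by (intro measurable_restrict) simp
    have "(\<Prod>l\<in>J. ?f t l) = (if t then \<Prod>l\<in>J. if l = 0 then 1/2 else 1 else \<Prod>l\<in>J. 1/2)" for t
    proof -
      have "(\<Prod>l\<in>J. ?f t l) = (\<Prod>l\<in>J. if l = 0 then 1/2 else if t then 1 else 1/2)"
        using J by (intro prod.cong) auto
      then show ?thesis
        by (cases t) simp_all
    qed
    then have "(\<lambda>x. \<Prod>l\<in>J. x l) \<circ> ?f =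
        (\<lambda>t. if t then \<Prod>l\<in>J. if l = 0 then 1/2 else 1 else \<Prod>l\<in>J. 1/2)"
      by (simp only: fun_eq_iff comp_def) simp
    then show ?thesis
      using distr_distr[OF g f]
      by (simp add: example_screening_def two_point_def del: prod_constant)
  qed
  have sets: "{..<1::nat} = {0}" "{..<2::nat} = {0, 1}" "{1..<3::nat} = {1, 2}" "{2..<3::nat} = {2}"
    by auto
  show "fit_prior coarse_market j = two_point (1/2) (1/2)"
    "quality_prior coarse_market j = two_point 1 (1/4)"
    "fit_prior fine_market j = two_point (1/2) (1/4)"
    "quality_prior fine_market j = two_point 1 (1/2)"
    using prod[of "{0}"] prod[of "{0, 1}"] prod[of "{1, 2}"] prod[of "{2}"]
    unfolding coarse_market_def fine_market_def screening_market_def market.simps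
      example_screening_simps sets
    by simp_all
qed

lemma valid_markets: "valid_market coarse_market" "valid_market fine_market"
  unfolding valid_market_def priors_example example_market_simps
  by (auto simp: regular_uniform01 prob_space_two_point in_support_two_point intro!: AE_two_point)

lemma valid_screening_example: "valid_screening example_screening"
proof -
  let ?b = "measure_pmf (bernoulli_pmf (1/2))" and ?N = "\<Pi>\<^sub>M l\<in>{..<3::nat}. borel :: real measure"
  let ?f = "\<lambda>t. \<lambda>l\<in>{..<3::nat}. if l = 0 then 1/2 else if t then 1 else 1/2 :: real"
  have f: "?f \<in> ?b \<rightarrow>\<^sub>M ?N"
    by (intro measurable_restrict) simp
  have comp [measurable]: "(\<lambda>x. x 0) \<in> borel_measurable ?N" "(\<lambda>x. x 1) \<in> borel_measurable ?N"
      "(\<lambda>x. x 2) \<in> borel_measurable ?N"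
    by (intro measurable_component_singleton; simp)+
  have prior: "screen_prior example_screening j = distr ?b ?N ?f" for j
    by (simp add: example_screening_def)
  have "prob_space (distr ?b ?N ?f)"
    by (intro measure_pmf.prob_space_distr f)
  moreover have "AE x in distr ?b ?N ?f. \<forall>l<3. 0 \<le> x l \<and> x l \<le> 1"
    unfolding all_less_3 by (subst AE_distr_iff[OF f]) (auto, measurable)
  moreover have "0 < measure (distr ?b ?N ?f)
      {x \<in> space ?N. \<forall>l<3. \<bar>x l - screen_prob example_screening j l\<bar> < \<epsilon>}" if "0 < \<epsilon>" for \<epsilon> j
  proof -
    let ?X = "{x \<in> space ?N. \<forall>l<3. \<bar>x l - screen_prob example_screening j l\<bar> < \<epsilon>}"
    have X: "?X \<in> sets ?N"
      unfolding all_less_3 by measurable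
    \<comment> \<open>The true screen probabilities are the vector drawn on \<open>True\<close>, so
      each of their neighborhoods has at least the mass of that outcome.\<close>
    have "0 < measure ?b {True}"
      by (simp add: measure_pmf_single)
    also have "\<dots> \<le> measure ?b (?f -` ?X \<inter> space ?b)"
      using that measurable_space[OF f, of True]
      by (intro measure_pmf.finite_measure_mono) (auto simp: screen_prob_example all_less_3)
    also have "\<dots> = measure (distr ?b ?N ?f) ?X"
      using measure_distr[OF f X] by simp
    finally show ?thesis .
  qed
  ultimately show ?thesis
    unfolding valid_screening_def prior example_screening_simps space_distr sets_distr by blast
qed

lemma fine_more_informative: "more_consumer_informative fine_market coarse_market"
  unfolding more_consumer_informative_def coarse_market_def fine_market_def
  using valid_screening_example by (intro exI[of _ example_screening] exI[of _ 1] exI[of _ 2]) simp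

section \<open>Learning in the coarse market\<close>

text \<open>Successes only favor quality 1 over 1/4, so the mean quality never drops below its prior
  value 5/8. The threshold 24/25 solves v * 5/8 = 3/5, where 3/5 is the cost 3/10 divided by the fit
  probability 1/2.\<close>

lemma coarse_index_pos:
  assumes h: "set (observed_qualities 0 h) \<subseteq> {True}" and v: "24/25 < v"
  shows "0 < search_index coarse_market h v 0"
proof -
  \<comment> \<open>The likelihood ratio of quality 1/4 against quality 1. The posterior mean
    decreases in \<open>q\<close> and equals 5/8 at \<open>q = 1\<close>, that is, before any
    observation.\<close>
  define q :: real where "q = (1/4) ^ length (observed_qualities 0 h)"
  have q: "0 < q" "q \<le> 1"
    by (simp_all add: q_def power_le_one)
  have le: "5/8 \<le> (1 + q * (1/4)) / (1 + q)"
    using q by (simp add: field_simps)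
  have Q: "(\<integral>x. x \<partial>quality_posterior coarse_market h 0) = (1 + q * (1/4)) / (1 + q)"
    using integral_bayes_posterior_two_point[of 1 "1/4" "\<lambda>x. x"] h
    by (simp add: quality_posterior_def bernoulli_likelihood_successes q_def)
  have P: "(\<integral>x. x \<partial>fit_posterior coarse_market h 0) = 1/2"
    using integral_bayes_posterior_two_point[of "1/2" "1/2" "\<lambda>x. x"]
    by (simp add: fit_posterior_def bernoulli_likelihood_half)
  have "24/25 * (5/8) < v * ((1 + q * (1/4)) / (1 + q))"
    using v le by (intro mult_less_le_imp_less) auto
  then show ?thesis
    unfolding search_index_def Q P by simp
qed

text \<open>This separates probability from learning: it holds almost surely in the coarse market
  and forces learning deterministically. As a countable combination of conditions on single rounds
  it is measurable.\<close>

definition recurrent_success :: "(nat \<Rightarrow> round_record) \<Rightarrow> bool" where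
  "recurrent_success H \<longleftrightarrow>
     (\<forall>i. snd (H i) \<in> {None, Some (0, True)}) \<and> (\<forall>n. \<exists>i\<ge>n. snd (H i) = Some (0, True))"

lemma observed_qualities_snoc:
  "observed_qualities 0 (h @ [r]) = observed_qualities 0 h @
     (case snd r of None \<Rightarrow> [] | Some (j, b) \<Rightarrow> if j = 0 then [b] else [])"
  by (auto simp: observed_qualities_def split: option.splits prod.splits)

lemma observed_qualities_successes:
  assumes "\<And>i. snd (H i) \<in> {None, Some (0, True)}"
  shows "set (observed_qualities 0 (map H [0..<i])) \<subseteq> {True}"
proof (induction i)
  case 0
  then show ?case by (simp add: observed_qualities_def)
next
  case (Suc i)
  then show ?case
    using assms[of i] by (auto simp: observed_qualities_snoc)
qed

text \<open>The count is nondecreasing, so it is enough that it is unbounded; every further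
  transaction raises it by one.\<close>

lemma number_of_successes_at_top:
  assumes "recurrent_success H"
  shows "filterlim (\<lambda>i. length (observed_qualities 0 (map H [0..<i]))) at_top sequentially"
proof -
  let ?n = "\<lambda>i. length (observed_qualities 0 (map H [0..<i]))"
  have "incseq ?n"
    by (intro incseq_SucI) (simp add: observed_qualities_snoc)
  have "\<exists>i. N \<le> ?n i" for N
  proof (induction N)
    case (Suc N)
    then obtain i where i: "N \<le> ?n i" ..
    obtain k where k: "k \<ge> i" "snd (H k) = Some (0, True)"
      using assms unfolding recurrent_success_def by blast
    have "Suc N \<le> ?n (Suc k)"
      using i k incseqD[OF \<open>incseq ?n\<close> k(1)] by (simp add: observed_qualities_snoc)
    then show ?case ..
  qed simp
  then show ?thesis
    using \<open>incseq ?n\<close> unfolding filterlim_at_top eventually_sequentially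
    by (meson incseqD order_trans)
qed

lemma learned_set_coarse:
  assumes "recurrent_success H"
  shows "learned_set coarse_market H = {0}"
proof -
  let ?h = "\<lambda>i. map H [0..<i]"
  let ?n = "\<lambda>i. length (observed_qualities 0 (?h i))"
  have succ: "set (observed_qualities 0 (?h i)) \<subseteq> {True}" for i
    using assms by (intro observed_qualities_successes) (simp add: recurrent_success_def)
  have ball: "{x. \<bar>x - \<theta>\<bar> < \<epsilon>} \<in> sets borel" for \<theta> \<epsilon> :: real
    by measurable
  \<comment> \<open>The fit prior is the point mass at the true value 1/2, so the fit probability is
    known from the start.\<close>
  have "measure (fit_posterior coarse_market (?h i) 0) {x. \<bar>x - 1/2\<bar> < \<epsilon>} = 1" if "0 < \<epsilon>" for \<epsilon> i
    using that measure_bayes_posterior_two_point[OF _ _ _ _ ball, of "1/2" "1/2"]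
    by (simp add: fit_posterior_def bernoulli_likelihood_half)
  then have "concentrates_at (\<lambda>i. fit_posterior coarse_market (?h i) 0) (fit_prob coarse_market 0)"
    by (simp add: concentrates_at_def)
  moreover have "(\<lambda>i. measure (quality_posterior coarse_market (?h i) 0) {x. \<bar>x - 1\<bar> < \<epsilon>}) \<longlonglongrightarrow> 1"
    if "0 < \<epsilon>" for \<epsilon>
  proof -
    \<comment> \<open>Whether the wrong quality 1/4 lies in the ball (\<open>c = 1\<close>) or not
      (\<open>c = 0\<close>), its posterior weight vanishes with the likelihood ratio.\<close>
    define c :: real where "c = indicator {x. \<bar>x - 1\<bar> < \<epsilon>} (1/4 :: real)"
    have "(\<lambda>i. (1/4 :: real) ^ ?n i) \<longlonglongrightarrow> 0"
      by (rule filterlim_compose[OF LIMSEQ_realpow_zero number_of_successes_at_top[OF assms]]) auto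
    then have "(\<lambda>i. (1 + (1/4) ^ ?n i * c) / (1 + (1/4) ^ ?n i)) \<longlonglongrightarrow> (1 + 0 * c) / (1 + 0)"
      by (intro tendsto_intros) auto
    moreover have "measure (quality_posterior coarse_market (?h i) 0) {x. \<bar>x - 1\<bar> < \<epsilon>} =
        (1 + (1/4) ^ ?n i * c) / (1 + (1/4) ^ ?n i)" for i
      using that measure_bayes_posterior_two_point[OF _ _ _ _ ball, of 1 "1/4"] succ[of i]
      by (simp add: quality_posterior_def bernoulli_likelihood_successes c_def)
    ultimately show ?thesis
      by simp
  qed
  then have "concentrates_at (\<lambda>i. quality_posterior coarse_market (?h i) 0) (quality coarse_market 0)"
    by (simp add: concentrates_at_def)
  ultimately show ?thesis
    by (auto simp: learned_set_def)
qed

text \<open>Infinitely often a consumer has value above 24/25 and a fit. As all earlier quality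
  realizations were successes, \<open>coarse_index_pos\<close> makes her inspect whatever the rest
  of the past, and she transacts.\<close>

lemma AE_history_coarse: "AE H in history_law coarse_market. recurrent_success H"
proof (rule AE_history_law_single)
  show "Measurable.pred (\<Pi>\<^sub>M i\<in>UNIV. count_space UNIV) recurrent_success"
    unfolding recurrent_success_def[abs_def]
    by (intro pred_intros_logic pred_intros_countable pred_history_component)
next
  let ?B = "{z \<in> space (draw_space coarse_market). fst z \<in> {24/25<..} \<and> fst (snd z 0)}"
  have B: "?B \<in> sets (draw_space coarse_market)" "0 < measure (draw_space coarse_market) ?B"
    using measure_draw_space_single[of coarse_market "{24/25<..}"] prob_space_uniform01
    by (simp_all add: measure_uniform01_greaterThan)
  have "AE \<omega> in draws coarse_market. \<forall>n. \<exists>i\<ge>n. \<omega> i \<in> ?B"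
    unfolding draws_eq using B
    by (intro AE_PiM_infinitely_often prob_space_draw_space) (simp_all add: prob_space_uniform01)
  moreover have "AE \<omega> in draws coarse_market. \<forall>i. snd (snd (\<omega> i) 0)"
  proof (rule AE_draws_all)
    have "AE (v, x) in draw_space coarse_market. True \<and> (\<forall>j<businesses coarse_market. snd (x j))"
      by (rule AE_draw_space) (auto simp: prob_space_uniform01 quality_realization_coarse)
    then show "AE z in draw_space coarse_market. snd (snd z 0)"
      by eventually_elim auto
  qed (simp add: prob_space_uniform01)
  ultimately show "AE \<omega> in draws coarse_market. recurrent_success (infinite_history coarse_market \<omega>)"
  proof eventually_elim
    case (elim \<omega>)
    let ?H = "infinite_history coarse_market \<omega>"
    let ?x = "\<lambda>i. snd (\<omega> i)"
    have round: "?H i =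
        (if 0 < search_index coarse_market (map ?H [0..<i]) (fst (\<omega> i)) 0
         then if fst (?x i 0) then ([(0, True)], Some (0, snd (?x i 0))) else ([(0, False)], None)
         else ([], None))" for i
      using play_round_single[of coarse_market "map ?H [0..<i]" "fst (\<omega> i)" "?x i"]
      by (simp add: infinite_history_def rounds_upto_eq[symmetric])
    have succ: "snd (?H i) \<in> {None, Some (0, True)}" for i
      using elim(2) by (subst round) auto
    have "snd (?H i) = Some (0, True)" if "\<omega> i \<in> ?B" for i
      using that elim(2) coarse_index_pos[OF observed_qualities_successes[of ?H i], OF succ]
      by (subst round) auto
    with succ elim(1) show ?case
      unfolding recurrent_success_def by blast
  qed
qed simp_all

section \<open>No search in the fine market\<close>

lemma observed_empty_rounds:
  assumes "set h \<subseteq> {([], None)}"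
  shows "observed_fits j h = []" "observed_qualities j h = []"
  using assms by (induction h) (auto simp: observed_fits_def observed_qualities_def)

text \<open>Nothing was observed, so the means are the prior ones, 3/4 and 3/8. Even the top value 1
  yields only 3/4, less than the effective cost (3/10) / (3/8) = 4/5.\<close>

lemma fine_index_neg:
  assumes h: "set h \<subseteq> {([], None)}" and v: "v \<le> 1"
  shows "search_index fine_market h v 0 < 0"
proof -
  have Q: "(\<integral>x. x \<partial>quality_posterior fine_market h 0) = 3/4"
    using integral_bayes_posterior_two_point[of 1 "1/2" "\<lambda>x. x"]
    by (simp add: quality_posterior_def observed_empty_rounds[OF h])
  have P: "(\<integral>x. x \<partial>fit_posterior fine_market h 0) = 3/8"
    using integral_bayes_posterior_two_point[of "1/2" "1/4" "\<lambda>x. x"]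
    by (simp add: fit_posterior_def observed_empty_rounds[OF h])
  show ?thesis
    unfolding search_index_def Q P using v by simp
qed

text \<open>Absence of search perpetuates itself: as long as nobody has inspected, beliefs stay at
  the prior, and no consumer with value at most 1 inspects. Chance enters only through this bound on
  the values.\<close>

lemma AE_history_fine: "AE H in history_law fine_market. \<forall>i. H i = ([], None)"
proof (rule AE_history_law_single)
  show "Measurable.pred (\<Pi>\<^sub>M i\<in>UNIV. count_space UNIV) (\<lambda>H. \<forall>i::nat. H i = ([], None))"
    by (intro pred_intros_countable pred_history_component)
next
  have "AE \<omega> in draws fine_market. \<forall>i. fst (\<omega> i) \<le> 1"
  proof (rule AE_draws_all)
    have "AE (v, x) in draw_space fine_market. (0 \<le> v \<and> v \<le> 1) \<and> (\<forall>j<businesses fine_market. True)"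
      by (rule AE_draw_space) (simp_all only: example_market_simps prob_space_uniform01 AE_uniform01)
    then show "AE z in draw_space fine_market. fst z \<le> 1"
      by eventually_elim auto
  qed (simp add: prob_space_uniform01)
  then show "AE \<omega> in draws fine_market. \<forall>i. infinite_history fine_market \<omega> i = ([], None)"
  proof eventually_elim
    case (elim \<omega>)
    show ?case
    proof
      fix i
      show "infinite_history fine_market \<omega> i = ([], None)"
      proof (induction i rule: less_induct)
        case (less i)
        then have "set (rounds_upto fine_market \<omega> i) \<subseteq> {([], None)}"
          by (auto simp: rounds_upto_eq)
        from fine_index_neg[OF this] elim
        have "\<not> 0 < search_index fine_market (rounds_upto fine_market \<omega> i) (fst (\<omega> i)) 0"
          by (simp add: not_less less_imp_le)
        then show ?case
          using play_round_single[of fine_market "rounds_upto fine_market \<omega> i" "fst (\<omega> i)" "snd (\<omega> i)"]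
          by (simp add: infinite_history_def)
      qed
    qed
  qed
qed simp_all

lemma learned_set_fine:
  assumes "\<forall>i. H i = ([], None)"
  shows "learned_set fine_market H = {}"
proof -
  \<comment> \<open>The radius 1/8 is less than the distance 1/4 between the two prior values 1/2
    and 1/4. The ball thus keeps the prior mass 1/2 forever, and the fit probability is not
    learned.\<close>
  have ball: "{x::real. \<bar>x - 1/2\<bar> < 1/8} \<in> sets borel"
    by measurable
  have "measure (fit_posterior fine_market (map H [0..<i]) 0) {x. \<bar>x - 1/2\<bar> < 1/8} = 1/2" for i
  proof -
    have "observed_fits 0 (map H [0..<i]) = []"
      using assms by (intro observed_empty_rounds) auto
    then show ?thesis
      using measure_bayes_posterior_two_point[OF _ _ _ _ ball, of "1/2" "1/4" "[]"]
      by (simp add: fit_posterior_def)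
  qed
  then have "\<not> (\<lambda>i. measure (fit_posterior fine_market (map H [0..<i]) 0)
      {x. \<bar>x - 1/2\<bar> < 1/8}) \<longlonglongrightarrow> 1"
    by (simp only: LIMSEQ_const_iff)
  moreover have "0 < (1/8 :: real)"
    by simp
  ultimately have "\<not> concentrates_at (\<lambda>i. fit_posterior fine_market (map H [0..<i]) 0)
      (fit_prob fine_market 0)"
    unfolding concentrates_at_def fit_prob_example by blast
  then show ?thesis
    by (auto simp: learned_set_def)
qed

section \<open>The utility gap and the conclusion\<close>

lemma coarse_utility_pos: "0 < optimal_utility coarse_market {0}"
proof -
  interpret prob_space uniform01
    by (rule prob_space_uniform01)
  let ?u = "\<lambda>v. max 0 (v / 2 - 3/10) :: real"
  have "integrable uniform01 ?u"
    using AE_uniform01 by (intro integrable_const_bound[of _ 1]) auto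
  \<comment> \<open>A step function below the utility: v/2 - 3/10 exceeds 1/10 once v exceeds 4/5,
    so the integral is at least 1/10 * 1/5.\<close>
  moreover have "integrable uniform01 (\<lambda>v. 1/10 * indicator {4/5<..} v :: real)"
    by (intro integrable_const_bound[of _ 1]) (auto simp: indicator_def)
  ultimately have "(\<integral>v. 1/10 * indicator {4/5<..} v \<partial>uniform01) \<le> (\<integral>v. ?u v \<partial>uniform01)"
    by (intro integral_mono) (auto simp: indicator_def)
  then show ?thesis
    using optimal_utility_single_free[of coarse_market]
    by (simp add: measure_uniform01_greaterThan)
qed

theorem proposition6p5:
  shows "\<exists>M Mt. valid_market M \<and> valid_market Mt \<and> more_consumer_informative Mt M \<and>
    (\<exists>C. coupling C (history_law M) (history_law Mt) \<and>
      (AE (H, Ht) in C.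
        learned_set Mt Ht \<subset> learned_set M H \<and> long_run_utility Mt Ht < long_run_utility M H))"
proof (intro exI conjI)
  show "valid_market coarse_market" "valid_market fine_market" "more_consumer_informative fine_market coarse_market"
    by (simp_all add: valid_markets fine_more_informative)
  have coarse: "prob_space (history_law coarse_market)" and fine: "prob_space (history_law fine_market)"
    by (intro prob_space_history_law_single; simp add: prob_space_uniform01)+
  show "coupling (history_law coarse_market \<Otimes>\<^sub>M history_law fine_market) (history_law coarse_market) (history_law fine_market)"
    by (rule coupling_pair_measure[OF coarse fine])
  have "AE (H, Ht) in history_law coarse_market \<Otimes>\<^sub>M history_law fine_market.
      recurrent_success H \<and> (\<forall>i. Ht i = ([], None))"
    by (rule AE_pair_fst_snd[OF coarse fine AE_history_coarse AE_history_fine])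
  then show "AE (H, Ht) in history_law coarse_market \<Otimes>\<^sub>M history_law fine_market.
      learned_set fine_market Ht \<subset> learned_set coarse_market H \<and>
      long_run_utility fine_market Ht < long_run_utility coarse_market H"
  proof eventually_elim
    case (elim z)
    then show ?case
      using coarse_utility_pos
      by (auto simp: learned_set_coarse learned_set_fine long_run_utility_def optimal_utility_empty
          split: prod.splits)
  qed
qed

end
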